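(* Let $n\ge 1$, let $A_1,\dots,A_n$ be sets and let $A=A_1\times\cdots\times A_n$. If $|A|>1$, then the map $\gamma:\Sigma\to\mathcal P(A^{\omega})$, which sends a strategy vector $\sigma$ on $A$ to the language of infinite words it generates, is neither injective nor surjective.
   Context: $A_i$ is the set of actions of player $i$ and $A=A_1\times\cdots\times A_n$ is the alphabet of moves. $A^*$ is the set of finite words on $A$ (including the empty word $\epsilon$), $A^{\omega}$ the set of infinite words $h=h_0h_1h_2\cdots$ on $A$, and $\mathcal P(A^{\omega})$ the set of all subsets (languages) of $A^{\omega}$. A (nondeterministic) strategy for player $i$ is a relation $\sigma_i$ from $A^*$ to $A_i$, i.e. it assigns to each $w\in A^*$ a (possibly empty) subset $\sigma_i(w)\subseteq A_i$. A strategy vector on $A$ is a relation $\sigma=(\sigma_1,\dots,\sigma_n)$ from $A^*$ to $A$ of the form $(a_1,\dots,a_n)\in\sigma(w)\iff a_i\in\sigma_i(w)$ for all $1\le i\le n$. Strategy vectors are regarded as relations from $A^*$ to $A$ (equal iff $\sigma(w)=\sigma'(w)$ for all $w$). $\Sigma$ is the set of all strategy vectors on $A$, and $$\gamma(\sigma)=\{h\in A^{\omega}\mid h_0\in\sigma(\epsilon)\text{ and }h_{t+1}\in\sigma(h_0\cdots h_t)\ \forall t\ge 0\}.$$ *)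

theory Defs
  imports "HOL-Library.FuncSet" "HOL-Library.Stream"
begin

text \<open>Players are numbered \<open>1, \<dots>, n\<close>, and the action sets \<open>A 1, \<dots>, A n\<close> are arbitrary
  (possibly infinite) subsets of a common type. Finite and infinite words on the alphabet
  \<open>moves n A\<close> are \<open>lists (moves n A)\<close> and \<open>streams (moves n A)\<close>.\<close>

definition moves :: "nat \<Rightarrow> (nat \<Rightarrow> 'a set) \<Rightarrow> (nat \<Rightarrow> 'a) set" where
  "moves n A = (\<Pi>\<^sub>E i\<in>{1..n}. A i)"

text \<open>The set of actions that a relation \<open>s\<close> assigns to a word \<open>w\<close> is \<open>s `` {w}\<close>; it may be
  empty.\<close>

definition strategies :: "nat \<Rightarrow> (nat \<Rightarrow> 'a set) \<Rightarrow> nat \<Rightarrow> ((nat \<Rightarrow> 'a) list \<times> 'a) set set" where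
  "strategies n A i = Pow (lists (moves n A) \<times> A i)"

definition strategy_vector ::
  "nat \<Rightarrow> (nat \<Rightarrow> 'a set) \<Rightarrow> (nat \<Rightarrow> ((nat \<Rightarrow> 'a) list \<times> 'a) set) \<Rightarrow>
     ((nat \<Rightarrow> 'a) list \<times> (nat \<Rightarrow> 'a)) set" where
  "strategy_vector n A s =
     {(w, a). w \<in> lists (moves n A) \<and> a \<in> moves n A \<and> (\<forall>i\<in>{1..n}. (w, a i) \<in> s i)}"

text \<open>Strategy vectors are identified with relations from finite words to moves, so tuples of
  strategies inducing the same relation give the same element.\<close>

definition strategy_vectors ::
  "nat \<Rightarrow> (nat \<Rightarrow> 'a set) \<Rightarrow> ((nat \<Rightarrow> 'a) list \<times> (nat \<Rightarrow> 'a)) set set" where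
  "strategy_vectors n A =
     {strategy_vector n A s | s. \<forall>i\<in>{1..n}. s i \<in> strategies n A i}"

definition \<gamma> ::
  "nat \<Rightarrow> (nat \<Rightarrow> 'a set) \<Rightarrow> ((nat \<Rightarrow> 'a) list \<times> (nat \<Rightarrow> 'a)) set \<Rightarrow> (nat \<Rightarrow> 'a) stream set" where
  "\<gamma> n A \<sigma> =
     {h \<in> streams (moves n A).
        h !! 0 \<in> \<sigma> `` {[]} \<and> (\<forall>t. h !! (t + 1) \<in> \<sigma> `` {stake (t + 1) h})}"

lemma \<gamma>_funcset: "\<gamma> n A \<in> strategy_vectors n A \<rightarrow> Pow (streams (moves n A))"
  by (auto simp: \<gamma>_def)

end

theory Submission
  imports Defs
begin

text \<open>Whatever happens after words that a strategy vector never produces is invisible to \<open>\<gamma>\<close>: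
  two strategy vectors that allow no first move both generate the empty language. On the other
  hand, a generated language is closed (a word belongs to it as soon as each of its finite prefixes
  extends to a member), so removing a single word from the full language gives a language outside
  the range of \<open>\<gamma>\<close>.\<close>

lemma strategy_vector_in_strategy_vectors:
  assumes "\<And>i. i \<in> {1..n} \<Longrightarrow> s i \<in> strategies n A i"
  shows "strategy_vector n A s \<in> strategy_vectors n A"
  using assms by (auto simp: strategy_vectors_def)

lemma \<gamma>_eq_empty: "\<sigma> `` {[]} = {} \<Longrightarrow> \<gamma> n A \<sigma> = {}"
  by (simp add: \<gamma>_def)

text \<open>Since \<open>stake 0 h = []\<close>, the clause on the first move is the case t = 0 of
  the other one, so a single condition covers all t.\<close>

lemma in_\<gamma>_iff:
  "h \<in> \<gamma> n A \<sigma> \<longleftrightarrow> h \<in> streams (moves n A) \<and> (\<forall>t. (stake t h, h !! t) \<in> \<sigma>)"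
proof -
  have "(\<forall>t. P t) \<longleftrightarrow> P 0 \<and> (\<forall>t. P (t + 1))" for P :: "nat \<Rightarrow> bool"
    by (metis Suc_eq_plus1 not0_implies_Suc)
  from this[of "\<lambda>t. (stake t h, h !! t) \<in> \<sigma>"] show ?thesis
    by (simp add: \<gamma>_def)
qed

lemma \<gamma>_closed:
  assumes "h \<in> streams (moves n A)"
    and "\<And>t. \<exists>g \<in> \<gamma> n A \<sigma>. stake t g = stake t h"
  shows "h \<in> \<gamma> n A \<sigma>"
  unfolding in_\<gamma>_iff
proof (intro conjI allI)
  fix t
  \<comment> \<open>Length \<open>Suc t\<close>, not t: the shared prefix must also contain the
    letter \<open>h !! t\<close> whose legality is checked.\<close>
  obtain g where g: "g \<in> \<gamma> n A \<sigma>" "stake (Suc t) g = stake (Suc t) h"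
    using assms(2) by blast
  then have "stake t g = stake t h" "g !! t = h !! t"
    by (simp_all add: stake_Suc del: stake.simps(2))
  with g(1) show "(stake t h, h !! t) \<in> \<sigma>"
    by (metis in_\<gamma>_iff)
qed (fact assms(1))

lemma \<gamma>_not_inj_on:
  assumes "n \<ge> 1" and a: "a \<in> moves n A"
  shows "\<not> inj_on (\<gamma> n A) (strategy_vectors n A)"
proof
  assume inj: "inj_on (\<gamma> n A) (strategy_vectors n A)"
  define \<sigma> where "\<sigma> = strategy_vector n A (\<lambda>i. {})"
  \<comment> \<open>\<tau> differs from \<sigma> only at the word \<open>[a]\<close>, which it can
    never reach because it allows no move at \<open>[]\<close>.\<close>
  define \<tau> where "\<tau> = strategy_vector n A (\<lambda>i. {([a], a i)})"
  have "\<sigma> \<in> strategy_vectors n A" "\<tau> \<in> strategy_vectors n A"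
    unfolding \<sigma>_def \<tau>_def using a
    by (auto intro!: strategy_vector_in_strategy_vectors simp: strategies_def moves_def PiE_mem)
  moreover have "\<gamma> n A \<sigma> = {}" "\<gamma> n A \<tau> = {}"
    \<comment> \<open>Some player exists and has no action at \<open>[]\<close>, which blocks every
      joint first move; with no players the condition would hold vacuously.\<close>
    using \<open>n \<ge> 1\<close> by (auto intro!: \<gamma>_eq_empty simp: \<sigma>_def \<tau>_def strategy_vector_def)
  ultimately have "\<sigma> = \<tau>"
    using inj by (metis inj_onD)
  moreover have "([a], a) \<in> \<tau>" "([a], a) \<notin> \<sigma>"
    using a \<open>n \<ge> 1\<close> by (auto simp: \<sigma>_def \<tau>_def strategy_vector_def)
  ultimately show False
    by simp
qed

lemma streams_minus_sconst_not_generated: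
  assumes a: "a \<in> moves n A" and b: "b \<in> moves n A" and "a \<noteq> b"
  shows "\<gamma> n A \<sigma> \<noteq> streams (moves n A) - {sconst a}"
proof
  assume eq: "\<gamma> n A \<sigma> = streams (moves n A) - {sconst a}"
  have "sconst a \<in> \<gamma> n A \<sigma>"
  proof (rule \<gamma>_closed)
    show "sconst a \<in> streams (moves n A)"
      using a by (simp add: streams_iff_sset)
    fix t
    \<comment> \<open>Switching to b after t letters gives a word that still lies in the language
      and shares the first t letters with \<open>sconst a\<close>.\<close>
    let ?g = "replicate t a @- sconst b"
    have "?g \<in> streams (moves n A)"
      using a b by (auto simp: streams_iff_sset)
    moreover have "?g \<noteq> sconst a"
    proof -
      have "b \<in> sset ?g"
        by simp
      then show ?thesis
        using \<open>a \<noteq> b\<close> by (metis sset_sconst singletonD)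
    qed
    moreover have "stake t ?g = stake t (sconst a)"
      by (rule nth_equalityI) (simp_all add: stake_shift)
    ultimately show "\<exists>g \<in> \<gamma> n A \<sigma>. stake t g = stake t (sconst a)"
      using eq by blast
  qed
  with eq show False
    by blast
qed

theorem proposition3p3:
  fixes n :: nat and A :: "nat \<Rightarrow> 'a set"
  assumes "n \<ge> 1"
    and "infinite (moves n A) \<or> card (moves n A) > 1"
  shows "\<not> inj_on (\<gamma> n A) (strategy_vectors n A)
    \<and> \<gamma> n A ` strategy_vectors n A \<noteq> Pow (streams (moves n A))"
proof -
  obtain a b where ab: "a \<in> moves n A" "b \<in> moves n A" "a \<noteq> b"
  proof -
    \<comment> \<open>For arbitrary x this yields some move a; taking x = a then yields a second
      move b.\<close>
    have "\<not> (moves n A \<subseteq> {x})" for x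
      using assms(2) card_mono[of "{x}" "moves n A"] finite_subset[of "moves n A" "{x}"] by auto
    then show ?thesis
      using that by blast
  qed
  have "streams (moves n A) - {sconst a} \<notin> \<gamma> n A ` strategy_vectors n A"
    using streams_minus_sconst_not_generated[OF ab] by blast
  then show ?thesis
    using \<gamma>_not_inj_on[OF assms(1) ab(1)] by blast
qed

end
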